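(* Let $G=(V,E)$ be a finite connected graph that has an automorphism $\varphi:V\rightarrow V$ such that for every $v\in V$, $\varphi(v)\neq v$ and $\varphi(v)$ is not adjacent to $v$. Then $G$ admits a uniform avoidance coupling of two simple random walks.
   Context: A simple random walk on $G$ moves from a vertex $v$ to each of its neighbors with probability $1/d(v)$, where $d(v)$ is the degree of $v$; $x\sim y$ means adjacent. A Markovian avoidance process of two tokens $X,Y$ on $V$ is a (time-homogeneous) Markov chain on $V\times V$ with transition probabilities $T[(x,y)\rightarrow(x',y')]$ and stationary distribution $s$, such that $s(v,v)=0$ for all $v\in V$, and whenever $s(v,w)>0$ one has $T[(v,w)\rightarrow(w,u)]=0$ for all $u\in V$ (the tokens move in turn, $X$ first). A uniform avoidance coupling of two simple random walks on $G$ is a Markovian avoidance process such that for every state $(x,y)$ with $s(x,y)>0$: $\sum_{y'}T[(x,y)\rightarrow(x',y')]$ equals $1/d(x)$ if $x'\sim x$ and $0$ otherwise, and $\sum_{x'}T[(x,y)\rightarrow(x',y')]$ equals $1/d(y)$ if $y'\sim y$ and $0$ otherwise. $G$ admits such a coupling if one exists. *)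

theory Defs
  imports "HOL-Probability.Probability_Mass_Function" "Graph_Theory.Digraph_Component"
begin

text \<open>A finite simple undirected graph is modelled as a symmetric, loop-free digraph without
  multiple arcs (locale \<^locale>\<open>graph\<close>), so that \<^term>\<open>dominates G\<close> is the adjacency relation and
  \<^const>\<open>out_degree\<close> counts the neighbours of a vertex.\<close>

definition graph_automorphism :: "('a, 'b) pre_digraph \<Rightarrow> ('a \<Rightarrow> 'a) \<Rightarrow> bool" where
  "graph_automorphism G \<phi> \<longleftrightarrow>
     bij_betw \<phi> (verts G) (verts G) \<and>
     (\<forall>u\<in>verts G. \<forall>v\<in>verts G. u \<rightarrow>\<^bsub>G\<^esub> v \<longleftrightarrow> \<phi> u \<rightarrow>\<^bsub>G\<^esub> \<phi> v)"

text \<open>Time-homogeneous Markov chains are given by their transition kernel: \<^term>\<open>pmf (T x) y\<close> is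
  the probability of a step from \<open>x\<close> to \<open>y\<close>. Values of the kernel outside the state space are
  irrelevant.\<close>

definition markov_chain_on :: "'s set \<Rightarrow> ('s \<Rightarrow> 's pmf) \<Rightarrow> bool" where
  "markov_chain_on S T \<longleftrightarrow> (\<forall>x\<in>S. set_pmf (T x) \<subseteq> S)"

definition stationary_distribution_on :: "'s set \<Rightarrow> ('s \<Rightarrow> 's pmf) \<Rightarrow> 's pmf \<Rightarrow> bool" where
  "stationary_distribution_on S T s \<longleftrightarrow> set_pmf s \<subseteq> S \<and> bind_pmf s T = s"

definition markovian_avoidance_process ::
    "'a set \<Rightarrow> ('a \<times> 'a \<Rightarrow> ('a \<times> 'a) pmf) \<Rightarrow> ('a \<times> 'a) pmf \<Rightarrow> bool" where
  "markovian_avoidance_process V T s \<longleftrightarrow>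
     markov_chain_on (V \<times> V) T \<and>
     stationary_distribution_on (V \<times> V) T s \<and>
     (\<forall>v\<in>V. pmf s (v, v) = 0) \<and>
     (\<forall>v\<in>V. \<forall>w\<in>V. pmf s (v, w) > 0 \<longrightarrow> (\<forall>u\<in>V. pmf (T (v, w)) (w, u) = 0))"

definition srw_step :: "('a, 'b) pre_digraph \<Rightarrow> 'a \<Rightarrow> 'a \<Rightarrow> real" where
  "srw_step G v w = (if v \<rightarrow>\<^bsub>G\<^esub> w then 1 / real (out_degree G v) else 0)"

definition uniform_avoidance_coupling ::
    "('a, 'b) pre_digraph \<Rightarrow> ('a \<times> 'a \<Rightarrow> ('a \<times> 'a) pmf) \<Rightarrow> ('a \<times> 'a) pmf \<Rightarrow> bool" where
  "uniform_avoidance_coupling G T s \<longleftrightarrow>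
     markovian_avoidance_process (verts G) T s \<and>
     (\<forall>x\<in>verts G. \<forall>y\<in>verts G. pmf s (x, y) > 0 \<longrightarrow>
        (\<forall>x'\<in>verts G. (\<Sum>y'\<in>verts G. pmf (T (x, y)) (x', y')) = srw_step G x x') \<and>
        (\<forall>y'\<in>verts G. (\<Sum>x'\<in>verts G. pmf (T (x, y)) (x', y')) = srw_step G y y'))"

definition admits_uniform_avoidance_coupling :: "('a, 'b) pre_digraph \<Rightarrow> bool" where
  "admits_uniform_avoidance_coupling G \<longleftrightarrow> (\<exists>T s. uniform_avoidance_coupling G T s)"

end

theory Submission
  imports Defs
begin

text \<open>Token \<open>Y\<close> shadows token \<open>X\<close>: whenever \<open>X\<close> is at \<open>v\<close>, \<open>Y\<close> is at \<open>\<phi> v\<close>. Since \<open>\<phi>\<close> is an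
  automorphism, \<open>Y\<close> performs a simple random walk as well; the position \<open>\<phi> v\<close> of \<open>Y\<close> is not
  adjacent to \<open>v\<close>, so \<open>X\<close> cannot step onto it, and \<open>Y\<close> then moves to the image of the new position
  of \<open>X\<close>, which is a different vertex. The degree-proportional distribution of the simple random
  walk, transported to the graph of \<open>\<phi>\<close>, is stationary.\<close>

definition neighbours :: "('a, 'b) pre_digraph \<Rightarrow> 'a \<Rightarrow> 'a set" where
  "neighbours G v = {w. v \<rightarrow>\<^bsub>G\<^esub> w}"

lemma (in wf_digraph) neighbours_subset_verts: "neighbours G v \<subseteq> verts G"
  by (auto simp: neighbours_def adj_in_verts)

lemma (in fin_digraph) finite_neighbours: "finite (neighbours G v)"
  using neighbours_subset_verts finite_verts by (rule finite_subset)

lemma (in nomulti_digraph) card_neighbours: "card (neighbours G v) = out_degree G v"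
proof -
  have "neighbours G v = head G ` out_arcs G v"
    by (auto simp: neighbours_def arcs_ends_conv out_arcs_def)
  moreover have "inj_on (head G) (out_arcs G v)"
    by (auto intro!: inj_onI no_multi_arcs simp: arc_to_ends_def)
  ultimately show ?thesis
    by (simp add: out_degree_def card_image)
qed

lemma (in sym_digraph) neighbours_sym: "w \<in> neighbours G v \<longleftrightarrow> v \<in> neighbours G w"
  using arcs_ends_symmetric[OF sym_arcs] by (auto simp: neighbours_def)

text \<open>A path from \<open>v\<close> to a different vertex has a first arc. This excludes
  isolated vertices, at which \<open>pmf_of_set (neighbours G v)\<close> is unspecified.\<close>

lemma (in sym_digraph) neighbours_nonempty:
  assumes "Digraph_Component.connected G" "v \<in> verts G" "w \<in> verts G" "v \<noteq> w"
  shows "neighbours G v \<noteq> {}"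
proof -
  have "strongly_connected G"
    using sym_arcs assms(1) by (rule symmetric_connected_imp_strongly_connected)
  then have "v \<rightarrow>\<^sup>* w"
    using assms by blast
  then show ?thesis
    using assms(4) by (cases rule: converse_reachable_cases) (auto simp: neighbours_def)
qed

definition srw_kernel :: "('a, 'b) pre_digraph \<Rightarrow> 'a \<Rightarrow> 'a pmf" where
  "srw_kernel G v = pmf_of_set (neighbours G v)"

text \<open>The tail of a uniformly random arc is distributed proportionally to the degree.\<close>

definition srw_stationary :: "('a, 'b) pre_digraph \<Rightarrow> 'a pmf" where
  "srw_stationary G = map_pmf fst (pmf_of_set (arcs_ends G))"

lemma (in digraph) pmf_srw_kernel:
  assumes "neighbours G v \<noteq> {}"
  shows "pmf (srw_kernel G v) w = srw_step G v w"
  using assms finite_neighbours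
  by (simp add: srw_kernel_def srw_step_def card_neighbours indicator_def)
     (simp add: neighbours_def)

lemma (in fin_digraph) set_srw_kernel:
  "neighbours G v \<noteq> {} \<Longrightarrow> set_pmf (srw_kernel G v) = neighbours G v"
  using finite_neighbours by (simp add: srw_kernel_def)

lemma (in fin_digraph) finite_arcs_ends: "finite (arcs_ends G)"
  by (simp add: arcs_ends_def)

lemma (in fin_digraph) pmf_srw_stationary:
  assumes "arcs_ends G \<noteq> {}"
  shows "pmf (srw_stationary G) v = card (neighbours G v) / card (arcs_ends G)"
proof -
  have "arcs_ends G \<inter> fst -` {v} = Pair v ` neighbours G v"
    by (auto simp: neighbours_def)
  then have "card (arcs_ends G \<inter> fst -` {v}) = card (neighbours G v)"
    by (simp add: card_image inj_on_def)
  then show ?thesis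
    using assms finite_arcs_ends by (simp add: srw_stationary_def pmf_map measure_pmf_of_set)
qed

lemma (in fin_digraph) set_srw_stationary:
  assumes "arcs_ends G \<noteq> {}"
  shows "set_pmf (srw_stationary G) \<subseteq> verts G"
  using assms finite_arcs_ends by (auto simp: srw_stationary_def adj_in_verts)

text \<open>The degree of \<open>v\<close> cancels against the step probability, so each neighbour
  \<open>v\<close> of \<open>w\<close> passes on the same mass, one over the number of arcs. By
  symmetry, the vertices that can step to \<open>w\<close> are exactly
  \<open>neighbours G w\<close>, and the total is again proportional to the degree of
  \<open>w\<close>.\<close>

lemma (in pseudo_graph) bind_srw_stationary:
  assumes "arcs_ends G \<noteq> {}" and ne: "\<And>v. v \<in> verts G \<Longrightarrow> neighbours G v \<noteq> {}"
  shows "bind_pmf (srw_stationary G) (srw_kernel G) = srw_stationary G"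
proof (rule pmf_eqI)
  fix w
  have summand: "pmf (srw_kernel G v) w * pmf (srw_stationary G) v =
      indicator (neighbours G w) v / card (arcs_ends G)" if "v \<in> verts G" for v
    using ne[OF that] finite_neighbours assms(1) neighbours_sym[of w v]
    by (simp add: srw_kernel_def pmf_srw_stationary indicator_def)
  have "pmf (bind_pmf (srw_stationary G) (srw_kernel G)) w =
      (\<Sum>v\<in>verts G. pmf (srw_kernel G v) w * pmf (srw_stationary G) v)"
    using set_srw_stationary[OF assms(1)]
    by (subst pmf_bind, subst integral_measure_pmf_real[where A = "verts G"]) auto
  also have "\<dots> = (\<Sum>v\<in>verts G. indicator (neighbours G w) v) / card (arcs_ends G)"
    by (simp add: summand sum_divide_distrib)
  also have "(\<Sum>v\<in>verts G. indicator (neighbours G w) v :: real) = card (neighbours G w)"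
    using neighbours_subset_verts[of w]
    by (simp add: indicator_def sum.If_cases Int_absorb1)
  finally show "pmf (bind_pmf (srw_stationary G) (srw_kernel G)) w = pmf (srw_stationary G) w"
    using assms(1) by (simp add: pmf_srw_stationary)
qed

lemma pmf_map_graph: "pmf (map_pmf (\<lambda>v. (v, f v)) p) (x, y) = (if y = f x then pmf p x else 0)"
proof (cases "y = f x")
  case True
  have "inj (\<lambda>v. (v, f v))"
    by (simp add: inj_on_def)
  then show ?thesis
    using True pmf_map_inj'[of "\<lambda>v. (v, f v)" p x] by simp
next
  case False
  then show ?thesis
    by (auto intro!: pmf_map_outside)
qed

text \<open>An automorphism maps the neighbourhood of \<open>v\<close> bijectively onto that of
  \<open>\<phi> v\<close>, so both vertices have the same degree.\<close>

lemma (in nomulti_digraph) srw_step_automorphism: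
  assumes "graph_automorphism G \<phi>" "v \<in> verts G" "w \<in> verts G"
  shows "srw_step G (\<phi> v) (\<phi> w) = srw_step G v w"
proof -
  have bij: "bij_betw \<phi> (verts G) (verts G)"
    and adj: "\<And>u w. u \<in> verts G \<Longrightarrow> w \<in> verts G \<Longrightarrow> u \<rightarrow> w \<longleftrightarrow> \<phi> u \<rightarrow> \<phi> w"
    using assms(1) by (auto simp: graph_automorphism_def)
  have "neighbours G (\<phi> v) = \<phi> ` neighbours G v"
  proof (intro set_eqI iffI)
    fix y assume y: "y \<in> neighbours G (\<phi> v)"
    \<comment> \<open>Surjectivity supplies a preimage of \<open>y\<close>; reflecting adjacency
      then makes it a neighbour of \<open>v\<close>.\<close>
    then have "y \<in> \<phi> ` verts G"
      using neighbours_subset_verts bij by (auto simp: bij_betw_def)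
    then show "y \<in> \<phi> ` neighbours G v"
      using y adj assms(2) by (auto simp: neighbours_def)
  next
    fix y assume "y \<in> \<phi> ` neighbours G v"
    then show "y \<in> neighbours G (\<phi> v)"
      using adj assms(2) by (auto simp: neighbours_def dest: adj_in_verts(2))
  qed
  moreover have "inj_on \<phi> (neighbours G v)"
    using bij neighbours_subset_verts by (meson bij_betw_def inj_on_subset)
  ultimately have "out_degree G (\<phi> v) = out_degree G v"
    by (simp add: card_image flip: card_neighbours)
  then show ?thesis
    using adj assms(2,3) by (simp add: srw_step_def)
qed

theorem theorem8p1:
  fixes G :: "('a, 'b) pre_digraph" and \<phi> :: "'a \<Rightarrow> 'a"
  assumes "graph G"
    and "Digraph_Component.connected G"
    and "graph_automorphism G \<phi>"
    and "\<And>v. v \<in> verts G \<Longrightarrow> \<phi> v \<noteq> v \<and> \<not> v \<rightarrow>\<^bsub>G\<^esub> \<phi> v"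
  shows "admits_uniform_avoidance_coupling G"
proof -
  interpret graph G by fact
  have bij: "bij_betw \<phi> (verts G) (verts G)"
    using assms(3) by (simp add: graph_automorphism_def)
  have \<phi>_verts: "\<phi> v \<in> verts G" if "v \<in> verts G" for v
    using bij that by (auto simp: bij_betw_def)
  \<comment> \<open>The second vertex required here is \<open>\<phi> v\<close>, since
    \<open>\<phi>\<close> has no fixed point.\<close>
  have ne: "neighbours G v \<noteq> {}" if "v \<in> verts G" for v
    using neighbours_nonempty[OF assms(2) that \<phi>_verts[OF that]] assms(4)[OF that] by auto
  have "verts G \<noteq> {}"
    using assms(2) by (auto simp: connected_def strongly_connected_def)
  then have arcs: "arcs_ends G \<noteq> {}"
    using ne by (auto simp: neighbours_def)

  define shadow where "shadow p = map_pmf (\<lambda>v. (v, \<phi> v)) p" for p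
  \<comment> \<open>The position of \<open>Y\<close> is ignored: on the support of \<open>s\<close>
    it is determined as \<open>\<phi> x\<close>, and every step lands on the graph of
    \<open>\<phi>\<close> again.\<close>
  define T where "T = (\<lambda>(x, y :: 'a). shadow (srw_kernel G x))"
  define s where "s = shadow (srw_stationary G)"
  have pmf_shadow: "pmf (shadow p) (x, y) = (if y = \<phi> x then pmf p x else 0)" for p x y
    by (simp add: shadow_def pmf_map_graph)
  have s_pos: "y = \<phi> x" if "pmf s (x, y) > 0" for x y
    using that by (simp add: s_def pmf_shadow split: if_splits)

  have "markov_chain_on (verts G \<times> verts G) T"
    using neighbours_subset_verts \<phi>_verts
    by (fastforce simp: markov_chain_on_def T_def shadow_def set_srw_kernel ne)
  moreover have "stationary_distribution_on (verts G \<times> verts G) T s"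
  proof -
    \<comment> \<open>As \<open>T\<close> reads only the first coordinate, \<open>shadow\<close> can
      be pulled out of the bind, reducing stationarity to that of the single walk.\<close>
    have "bind_pmf s T = shadow (bind_pmf (srw_stationary G) (srw_kernel G))"
      by (simp add: s_def T_def shadow_def bind_map_pmf map_bind_pmf)
    also have "\<dots> = s"
      using arcs ne by (simp add: bind_srw_stationary s_def)
    finally show ?thesis
      using set_srw_stationary[OF arcs] \<phi>_verts
      by (auto simp: stationary_distribution_on_def s_def shadow_def)
  qed
  moreover have "pmf s (v, v) = 0" if "v \<in> verts G" for v
    using assms(4)[OF that] by (auto simp: s_def pmf_shadow)
  \<comment> \<open>Here \<open>w = \<phi> v\<close>, which is not adjacent to
    \<open>v\<close>.\<close>
  moreover have "pmf (T (v, w)) (w, u) = 0" if "v \<in> verts G" "pmf s (v, w) > 0" for v w u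
    using assms(4)[OF that(1)] s_pos[OF that(2)] ne[OF that(1)]
    by (simp add: T_def pmf_shadow pmf_srw_kernel srw_step_def)
  moreover have "(\<Sum>y'\<in>verts G. pmf (T (x, y)) (x', y')) = srw_step G x x'"
    if "x \<in> verts G" "x' \<in> verts G" for x y x'
    using that ne \<phi>_verts by (simp add: T_def pmf_shadow pmf_srw_kernel)
  moreover have "(\<Sum>x'\<in>verts G. pmf (T (x, y)) (x', y')) = srw_step G y y'"
    if x: "x \<in> verts G" and y': "y' \<in> verts G" and "pmf s (x, y) > 0" for x y y'
  proof -
    \<comment> \<open>\<open>Y\<close> reaches \<open>y'\<close> only when \<open>X\<close> moves to
      its unique preimage \<open>u\<close>, so the sum has one term, and \<open>\<phi>\<close>
      carries the step from \<open>x\<close> to \<open>u\<close> to the step from \<open>y\<close>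
      to \<open>y'\<close>.\<close>
    obtain u where u: "u \<in> verts G" "y' = \<phi> u"
      using bij y' by (auto simp: bij_betw_def)
    have "pmf (T (x, y)) (x', y') = (if x' = u then srw_step G x u else 0)"
      if "x' \<in> verts G" for x'
      using that u x bij ne
      by (auto simp: T_def pmf_shadow pmf_srw_kernel bij_betw_def dest: inj_onD)
    then have "(\<Sum>x'\<in>verts G. pmf (T (x, y)) (x', y')) = srw_step G x u"
      using u by simp
    then show ?thesis
      using srw_step_automorphism[OF assms(3) x u(1)] u(2) s_pos[OF that(3)]
      by simp
  qed
  ultimately have "uniform_avoidance_coupling G T s"
    by (simp add: uniform_avoidance_coupling_def markovian_avoidance_process_def)
  then show ?thesis
    unfolding admits_uniform_avoidance_coupling_def by blast
qed

end
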